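(* Let $n\ge 2$. Let $\mathbf L_{n-1}$ be a set containing exactly one representative from each LC orbit of connected simple undirected graphs on $n-1$ vertices. Let $\mathbf E_n$ be the set of all graphs obtained from some graph in $\mathbf L_{n-1}$ by adding one new vertex and joining it by edges to a nonempty subset of the old vertices (all $2^{n-1}-1$ such extensions of each graph). Then for every connected simple undirected graph $G$ on $n$ vertices, the LC orbit of $G$ contains a graph isomorphic to a member of $\mathbf E_n$; i.e. $\mathbf E_n$ contains at least one representative of each LC orbit of connected graphs on $n$ vertices.
   Context: Local complementation (LC) at a vertex $v$ of a graph $G$ replaces the induced subgraph on the neighbourhood $N_v$ of $v$ by its complement. The LC orbit of a graph $G$ is the set of all unlabeled graphs (graphs up to isomorphism) obtainable from $G$ by any finite sequence of local complementations. *)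

theory Defs
  imports "Graph_Theory.Graph_Theory"
begin

text \<open>
  A finite simple undirected graph is a \<open>pair_graph\<close>: a finite, loop-free, symmetric digraph
  whose arcs are pairs of vertices, so that an undirected edge is a pair of opposite arcs.
\<close>

definition connected_graph_on :: "nat \<Rightarrow> 'a pair_pre_digraph \<Rightarrow> bool" where
  "connected_graph_on m G \<longleftrightarrow>
     pair_graph G \<and> connected (with_proj G) \<and> card (pverts G) = m"

definition neighbourhood :: "'a pair_pre_digraph \<Rightarrow> 'a \<Rightarrow> 'a set" where
  "neighbourhood G v = {u. (v, u) \<in> parcs G}"

definition local_complement :: "'a pair_pre_digraph \<Rightarrow> 'a \<Rightarrow> 'a pair_pre_digraph" where
  "local_complement G v =
     (let N = neighbourhood G v
      in \<lparr> pverts = pverts G,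
           parcs = (parcs G - N \<times> N) \<union> {(x, y) \<in> N \<times> N. x \<noteq> y \<and> (x, y) \<notin> parcs G} \<rparr>)"

text \<open>
  The unlabeled graph of \<open>G\<close> is its isomorphism class. Every finite graph has isomorphic copies
  with vertices in \<open>nat\<close>, and the class is represented by the set of all of these; this makes
  the unlabeled graphs of graphs over different vertex types comparable.
\<close>

definition unlabeled :: "'a pair_pre_digraph \<Rightarrow> nat pair_pre_digraph set" where
  "unlabeled G = {H. digraph_iso (with_proj G) (with_proj H)}"

definition lc_orbit :: "'a pair_pre_digraph \<Rightarrow> nat pair_pre_digraph set set" where
  "lc_orbit G = {unlabeled (foldl local_complement G vs) | vs. set vs \<subseteq> pverts G}"

definition connected_lc_orbits :: "nat \<Rightarrow> nat pair_pre_digraph set set set" where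
  "connected_lc_orbits m = lc_orbit ` {H :: nat pair_pre_digraph. connected_graph_on m H}"

definition lc_representatives :: "nat \<Rightarrow> nat pair_pre_digraph set \<Rightarrow> bool" where
  "lc_representatives m L \<longleftrightarrow>
     (\<forall>K\<in>L. connected_graph_on m K) \<and>
     (\<forall>Orb\<in>connected_lc_orbits m. \<exists>!K. K \<in> L \<and> unlabeled K \<in> Orb)"

text \<open>The new vertex is \<open>None\<close>; an old vertex \<open>v\<close> becomes \<open>Some v\<close>.\<close>

definition extend_graph :: "'a pair_pre_digraph \<Rightarrow> 'a set \<Rightarrow> 'a option pair_pre_digraph" where
  "extend_graph K S =
     \<lparr> pverts = insert None (Some ` pverts K),
       parcs = map_prod Some Some ` parcs K \<union> {None} \<times> Some ` S \<union> Some ` S \<times> {None} \<rparr>"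

definition extensions :: "'a pair_pre_digraph set \<Rightarrow> 'a option pair_pre_digraph set" where
  "extensions L = {extend_graph K S | K S. K \<in> L \<and> S \<noteq> {} \<and> S \<subseteq> pverts K}"

end

theory Submission
  imports Defs
begin

text \<open>
  A connected graph \<open>G\<close> with at least two vertices has a vertex \<open>v\<close> such that \<open>G - v\<close> is connected:
  the complement of a maximal proper connected vertex set is a single vertex. Local complementation
  at a vertex other than \<open>v\<close> commutes with deleting \<open>v\<close>, so a sequence of local complementations
  that turns \<open>G - v\<close> into its representative \<open>K\<close> turns \<open>G\<close> into an extension of \<open>K\<close>. The vertex
  \<open>v\<close> never becomes isolated, because a complementation at \<open>u \<noteq> v\<close> alters the neighbourhood of \<open>v\<close>
  only if \<open>u\<close> is adjacent to \<open>v\<close>, and then \<open>u\<close> remains adjacent to \<open>v\<close>.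
\<close>

subsection \<open>Vertices whose removal preserves connectedness\<close>

text \<open>A walk that starts in \<open>S\<close> and ends outside must cross the boundary at some
  arc, and \<open>rtrancl_on\<close> keeps its target in \<open>V\<close>.\<close>

lemma rtrancl_on_leaves_set:
  assumes "(x, y) \<in> rtrancl_on V r" "x \<in> S" "y \<notin> S"
  shows "\<exists>a\<in>S. \<exists>b\<in>V - S. (a, b) \<in> r"
  using assms by (induct rule: rtrancl_on_induct) auto

text \<open>Every vertex of \<open>S\<close> reaches \<open>b\<close> through \<open>a\<close>;
  symmetry of \<open>r\<close> reverses these walks.\<close>

lemma rtrancl_on_insert_neighbour:
  assumes "sym r" "\<forall>x\<in>S. \<forall>y\<in>S. (x, y) \<in> rtrancl_on S r" "a \<in> S" "(a, b) \<in> r"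
  shows "\<forall>x\<in>insert b S. \<forall>y\<in>insert b S. (x, y) \<in> rtrancl_on (insert b S) r"
proof -
  let ?R = "rtrancl_on (insert b S) r"
  have S: "(x, y) \<in> ?R" if "x \<in> S" "y \<in> S" for x y
    using assms(2) that by (blast intro: rtrancl_on_mono[OF subset_refl subset_insertI])
  have xb: "(x, b) \<in> ?R" if "x \<in> S" for x
    using rtrancl_on_into_rtrancl_on[OF S[OF that assms(3)] assms(4)] assms(3) by simp
  have "sym ?R" using assms(1) by (rule rtrancl_on_sym)
  then have bx: "(b, x) \<in> ?R" if "x \<in> S" for x using xb[OF that] by (rule symD)
  show ?thesis using S xb bx by auto
qed

lemma ex_non_cut_vertex:
  assumes "finite V" "card V \<ge> 2" "sym r"
    and conn: "\<forall>x\<in>V. \<forall>y\<in>V. (x, y) \<in> rtrancl_on V r"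
  shows "\<exists>v\<in>V. \<forall>x\<in>V - {v}. \<forall>y\<in>V - {v}. (x, y) \<in> rtrancl_on (V - {v}) r"
proof -
  define C where "C = {S. S \<subset> V \<and> S \<noteq> {} \<and> (\<forall>x\<in>S. \<forall>y\<in>S. (x, y) \<in> rtrancl_on S r)}"
  have "finite C" unfolding C_def
    by (rule finite_subset[of _ "Pow V"]) (use assms(1) in auto)
  \<comment> \<open>Since \<open>V\<close> has at least two elements, a singleton is a proper
    subset, so \<open>C\<close> is nonempty and has a maximal member.\<close>
  obtain z where "z \<in> V" using assms(2) by fastforce
  moreover have "V \<noteq> {z}" using assms(2) by auto
  ultimately have "{z} \<in> C" by (auto simp: C_def)
  then obtain S where "S \<in> C" and max: "\<And>T. T \<in> C \<Longrightarrow> S \<subseteq> T \<Longrightarrow> S = T"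
    using finite_has_maximal[OF \<open>finite C\<close>] by (metis empty_iff)
  then have S: "S \<subset> V" "S \<noteq> {}" "\<forall>x\<in>S. \<forall>y\<in>S. (x, y) \<in> rtrancl_on S r"
    by (auto simp: C_def)
  obtain s t where "s \<in> S" "t \<in> V - S" using S by auto
  then have "(s, t) \<in> rtrancl_on V r" using conn S by auto
  from rtrancl_on_leaves_set[OF this \<open>s \<in> S\<close>] \<open>t \<in> V - S\<close>
  obtain a b where ab: "a \<in> S" "b \<in> V - S" "(a, b) \<in> r" by auto
  \<comment> \<open>Maximality excludes this larger set from \<open>C\<close>. As it is connected,
    it can only fail to be proper, so \<open>b\<close> is all that \<open>S\<close> misses.\<close>
  have "insert b S \<notin> C" using max[of "insert b S"] ab by auto
  moreover have "\<forall>x\<in>insert b S. \<forall>y\<in>insert b S. (x, y) \<in> rtrancl_on (insert b S) r"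
    using rtrancl_on_insert_neighbour[OF assms(3) S(3) ab(1,3)] .
  ultimately have "\<not> insert b S \<subset> V" unfolding C_def by simp
  then have "S = V - {b}" using ab S(1) by blast
  then show ?thesis using ab S(3) by blast
qed

section \<open>Connected and simple graphs in terms of vertex and arc sets\<close>

lemma connected_pair_graph_iff:
  assumes "pair_graph G"
  shows "connected (with_proj G) \<longleftrightarrow>
    pverts G \<noteq> {} \<and> (\<forall>x\<in>pverts G. \<forall>y\<in>pverts G. (x, y) \<in> rtrancl_on (pverts G) (parcs G))"
proof -
  interpret pair_graph G by fact
  \<comment> \<open>\<open>connected\<close> refers to the symmetric closure of the arcs, which here
    adds nothing.\<close>
  have "sym (parcs G)" using pair_sym_arcs by (simp add: symmetric_def)
  then have "(parcs G)\<^sup>s = parcs G" by (auto simp: symcl_def dest: symD)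
  then show ?thesis by (simp add: connected_conv)
qed

lemma pair_graph_iff:
  "pair_graph G \<longleftrightarrow>
    finite (pverts G) \<and> parcs G \<subseteq> pverts G \<times> pverts G \<and> sym (parcs G) \<and> irrefl (parcs G)"
proof
  assume "pair_graph G"
  then interpret pair_graph G .
  show "finite (pverts G) \<and> parcs G \<subseteq> pverts G \<times> pverts G \<and> sym (parcs G) \<and> irrefl (parcs G)"
    using pair_finite_verts pair_sym_arcs no_loops'
    by (auto simp: symmetric_def irrefl_def dest: wellformed')
next
  assume *: "finite (pverts G) \<and> parcs G \<subseteq> pverts G \<times> pverts G \<and> sym (parcs G) \<and> irrefl (parcs G)"
  then have "finite (parcs G)" by (auto intro: finite_subset)
  then show "pair_graph G"
    using * by unfold_locales (auto simp: symmetric_def irrefl_def)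
qed

lemma pair_wf_digraph_if_pair_graph:
  assumes "pair_graph G" shows "pair_wf_digraph G"
proof -
  interpret pair_graph G by fact
  show ?thesis ..
qed

subsection \<open>Relabelling and induced subgraphs\<close>

text \<open>An isomorphic copy when \<open>f\<close> is injective on the vertices. It stands in for
  isomorphism records, which also carry arc, head and tail maps.\<close>

definition map_graph :: "('a \<Rightarrow> 'b) \<Rightarrow> 'a pair_pre_digraph \<Rightarrow> 'b pair_pre_digraph" where
  "map_graph f G = \<lparr> pverts = f ` pverts G, parcs = map_prod f f ` parcs G \<rparr>"

definition induced :: "'a pair_pre_digraph \<Rightarrow> 'a set \<Rightarrow> 'a pair_pre_digraph" where
  "induced G S = \<lparr> pverts = S, parcs = parcs G \<inter> S \<times> S \<rparr>"

lemma map_graph_simps [simp]: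
  "pverts (map_graph f G) = f ` pverts G"
  "parcs (map_graph f G) = map_prod f f ` parcs G"
  by (simp_all add: map_graph_def)

lemma induced_simps [simp]:
  "pverts (induced G S) = S"
  "parcs (induced G S) = parcs G \<inter> S \<times> S"
  by (simp_all add: induced_def)

lemma pverts_local_complement [simp]: "pverts (local_complement G v) = pverts G"
  by (simp add: local_complement_def Let_def)

lemma in_parcs_local_complement:
  "(x, y) \<in> parcs (local_complement G v) \<longleftrightarrow>
    (if (v, x) \<in> parcs G \<and> (v, y) \<in> parcs G then x \<noteq> y \<and> (x, y) \<notin> parcs G
     else (x, y) \<in> parcs G)"
  by (auto simp: local_complement_def Let_def neighbourhood_def)

lemma pair_graph_eqI:
  fixes G H :: "'a pair_pre_digraph"
  assumes "pverts G = pverts H" "\<And>x y. (x, y) \<in> parcs G \<longleftrightarrow> (x, y) \<in> parcs H"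
  shows "G = H"
  using assms by (intro pair_pre_digraph.equality) auto

lemma digraph_iso_map_graph:
  assumes "pair_wf_digraph G" "inj_on f (pverts G)"
  shows "digraph_iso (with_proj G) (with_proj (map_graph f G))"
proof -
  let ?h = "\<lparr> iso_verts = f, iso_arcs = map_prod f f, iso_head = snd, iso_tail = fst \<rparr>"
  interpret pair_wf_digraph G by fact
  have "inj_on (map_prod f f) (parcs G)"
    using map_prod_inj_on[OF assms(2,2)] by (rule inj_on_subset) (auto dest: wellformed')
  then have "pre_digraph.digraph_isomorphism (with_proj G) ?h"
    using assms by (auto simp: pre_digraph.digraph_isomorphism_def wf_digraph_wp_iff)
  moreover have "with_proj (map_graph f G) = app_iso ?h (with_proj G)"
    by (simp add: app_iso_def with_proj_def)
  ultimately show ?thesis unfolding digraph_iso_def by blast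
qed

text \<open>The tail and head maps of \<open>with_proj H\<close> are \<open>fst\<close> and
  \<open>snd\<close>, so the image of an arc is the pair of images of its ends: the vertex map
  determines the arc map.\<close>

lemma digraph_isoE_map_graph:
  assumes "digraph_iso (with_proj G) (with_proj H)"
  obtains f where "inj_on f (pverts G)" "H = map_graph f G"
proof -
  from assms obtain h where h: "pre_digraph.digraph_isomorphism (with_proj G) h"
    and H: "with_proj H = app_iso h (with_proj G)"
    by (auto simp: digraph_iso_def)
  have v: "pverts H = iso_verts h ` pverts G" and a: "parcs H = iso_arcs h ` parcs G"
    and t: "fst = iso_tail h" and d: "snd = iso_head h"
    using H by (auto simp: with_proj_def app_iso_def)
  have "iso_arcs h e = map_prod (iso_verts h) (iso_verts h) e" if "e \<in> parcs G" for e
    using h that unfolding pre_digraph.digraph_isomorphism_def t[symmetric] d[symmetric]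
    by (auto intro: prod_eqI)
  then have "H = map_graph (iso_verts h) G"
    using v a by (intro pair_pre_digraph.equality) (auto simp: image_iff)
  moreover have "inj_on (iso_verts h) (pverts G)"
    using h by (auto simp: pre_digraph.digraph_isomorphism_def)
  ultimately show thesis by (rule that[rotated])
qed

text \<open>Isomorphisms compose and can be inverted. The vertex types may differ, as is needed to
  compare \<open>G\<close> with an extension over \<open>nat option\<close>.\<close>

lemma unlabeled_eq_iff:
  fixes G :: "'a pair_pre_digraph" and H :: "'b pair_pre_digraph"
  assumes "pair_wf_digraph G" "digraph_iso (with_proj G) (with_proj H)"
  shows "unlabeled G = unlabeled H"
  using assms digraph_iso_swap[of "with_proj G" "with_proj H"]
  unfolding unlabeled_def wf_digraph_wp_iff by (blast intro: digraph_iso_trans)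

lemma in_unlabeled_self:
  assumes "pair_wf_digraph G" shows "G \<in> unlabeled G"
proof -
  have "map_graph id G = G" by (rule pair_graph_eqI) (simp_all add: map_prod.id)
  then show ?thesis using digraph_iso_map_graph[OF assms, of id] by (simp add: unlabeled_def)
qed

lemma in_map_graph_parcs:
  assumes "pair_wf_digraph G" "inj_on f (pverts G)" "x \<in> pverts G" "y \<in> pverts G"
  shows "(f x, f y) \<in> map_prod f f ` parcs G \<longleftrightarrow> (x, y) \<in> parcs G"
proof -
  interpret pair_wf_digraph G by fact
  show ?thesis
  proof
    assume "(f x, f y) \<in> map_prod f f ` parcs G"
    then obtain a b where "(a, b) \<in> parcs G" "f x = f a" "f y = f b" by auto
    moreover from this have "a \<in> pverts G" "b \<in> pverts G" by (auto dest: wellformed')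
    ultimately show "(x, y) \<in> parcs G" using assms(2-4) by (auto dest: inj_onD)
  qed force
qed

lemma pair_graph_map_graph:
  assumes "pair_graph G" "inj_on f (pverts G)"
  shows "pair_graph (map_graph f G)"
  using assms unfolding pair_graph_iff
  by (fastforce simp: sym_def irrefl_def dest: inj_onD)

lemma pair_graph_induced:
  assumes "pair_graph G" "S \<subseteq> pverts G"
  shows "pair_graph (induced G S)"
  using assms unfolding pair_graph_iff
  by (auto simp: sym_def irrefl_def intro: finite_subset)

lemma connected_graph_on_map_graph:
  assumes "connected_graph_on m G" "inj_on f (pverts G)"
  shows "connected_graph_on m (map_graph f G)"
proof -
  have G: "pair_graph G" using assms(1) by (simp add: connected_graph_on_def)
  then interpret pair_graph G .
  from digraph_iso_map_graph[OF _ assms(2)]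
  obtain h where "digraph_isomorphism h" "with_proj (map_graph f G) = app_iso h (with_proj G)"
    unfolding digraph_iso_def by (meson pair_wf_digraph_axioms)
  then have "connected (with_proj (map_graph f G))"
    using assms(1) by (simp add: connected_graph_on_def connectedI_app_iso)
  then show ?thesis
    using assms pair_graph_map_graph[OF G] by (simp add: connected_graph_on_def card_image)
qed

lemma ex_connected_vertex_deletion:
  assumes "connected_graph_on n G" "n \<ge> 2"
  shows "\<exists>v\<in>pverts G. connected_graph_on (n - 1) (induced G (pverts G - {v}))"
proof -
  let ?V = "pverts G"
  have G: "pair_graph G" and card: "card ?V = n"
    and conn: "\<forall>x\<in>?V. \<forall>y\<in>?V. (x, y) \<in> rtrancl_on ?V (parcs G)"
    using assms(1) by (auto simp: connected_graph_on_def connected_pair_graph_iff)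
  have fin: "finite ?V" and sym: "sym (parcs G)" using G by (auto simp: pair_graph_iff)
  obtain v where v: "v \<in> ?V"
    and *: "\<forall>x\<in>?V - {v}. \<forall>y\<in>?V - {v}. (x, y) \<in> rtrancl_on (?V - {v}) (parcs G)"
    using ex_non_cut_vertex[OF fin _ sym conn] card assms(2) by auto
  \<comment> \<open>A walk inside \<open>S\<close> only uses arcs with both ends in
    \<open>S\<close>, hence arcs of the induced subgraph.\<close>
  have restrict: "(x, y) \<in> rtrancl_on S (r \<inter> S \<times> S)" if "(x, y) \<in> rtrancl_on S r" for x y S r
    using that by (induct rule: rtrancl_on_induct) (auto intro: rtrancl_on_into_rtrancl_on)
  have H: "pair_graph (induced G (?V - {v}))" using G by (rule pair_graph_induced) auto
  have c: "card (?V - {v}) = n - 1" using v fin card by simp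
  then have "card (?V - {v}) \<noteq> 0" using assms(2) by simp
  then have "?V - {v} \<noteq> {}" by (metis card.empty)
  then show ?thesis
    using v c H *
    by (intro bexI[of _ v]) (auto simp: connected_graph_on_def connected_pair_graph_iff intro!: restrict)
qed

subsection \<open>Sequences of local complementations\<close>

lemma pair_graph_local_complement:
  assumes "pair_graph G"
  shows "pair_graph (local_complement G v)"
  using assms unfolding pair_graph_iff
  by (fastforce simp: sym_def irrefl_def in_parcs_local_complement split: if_splits)

text \<open>Local complementation depends on adjacency alone. If \<open>v\<close> were not a vertex,
  \<open>f v\<close> could be the label of another one.\<close>

lemma local_complement_map_graph:
  assumes "pair_wf_digraph G" "inj_on f (pverts G)" "v \<in> pverts G"
  shows "local_complement (map_graph f G) (f v) = map_graph f (local_complement G v)"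
proof (rule pair_graph_eqI)
  fix x y
  interpret pair_wf_digraph G by fact
  let ?H = "local_complement G v"
  have H: "pair_wf_digraph ?H"
    using assms(1) by unfold_locales (auto simp: in_parcs_local_complement split: if_splits dest: wellformed')
  show "(x, y) \<in> parcs (local_complement (map_graph f G) (f v)) \<longleftrightarrow>
      (x, y) \<in> parcs (map_graph f ?H)"
  proof (cases "x \<in> f ` pverts G \<and> y \<in> f ` pverts G")
    case True
    then obtain a b where ab: "a \<in> pverts G" "b \<in> pverts G" "x = f a" "y = f b" by auto
    then show ?thesis
      using assms in_map_graph_parcs[OF H, of f a b]
      by (simp add: in_parcs_local_complement in_map_graph_parcs inj_on_eq_iff)
  next
    case False
    \<comment> \<open>A pair with an end outside the image is an arc of neither relabelled graph,
      and that end is no neighbour of \<open>f v\<close>, so the pair is not toggled.\<close>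
    then have "(x, y) \<notin> map_prod f f ` parcs G" "(f v, x) \<notin> map_prod f f ` parcs G
        \<or> (f v, y) \<notin> map_prod f f ` parcs G" "(x, y) \<notin> map_prod f f ` parcs ?H"
      using pair_wf_digraph.wellformed'[OF H] by (auto dest: wellformed')
    then show ?thesis by (auto simp: in_parcs_local_complement)
  qed
qed simp

text \<open>Whether a pair in \<open>S\<close> is toggled depends only on the adjacency of its two
  ends to \<open>v\<close>, and these arcs survive in the subgraph because \<open>v\<close> is in
  \<open>S\<close>.\<close>

lemma local_complement_induced:
  assumes "v \<in> S"
  shows "local_complement (induced G S) v = induced (local_complement G v) S"
  using assms by (intro pair_graph_eqI) (auto simp: in_parcs_local_complement)

lemma neighbourhood_local_complement_nonempty:
  assumes "pair_graph G" "u \<noteq> v" "neighbourhood G v \<noteq> {}"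
  shows "neighbourhood (local_complement G u) v \<noteq> {}"
proof (cases "(u, v) \<in> parcs G")
  case True
  \<comment> \<open>No arc at \<open>u\<close> is toggled, since \<open>u\<close> is not in its own
    neighbourhood.\<close>
  then have "(v, u) \<in> parcs (local_complement G u)"
    using assms(1) unfolding pair_graph_iff
    by (auto simp: in_parcs_local_complement sym_def irrefl_def)
  then show ?thesis by (auto simp: neighbourhood_def)
next
  case False
  then show ?thesis using assms(3) by (auto simp: neighbourhood_def in_parcs_local_complement)
qed

lemma pverts_foldl_local_complement [simp]:
  "pverts (foldl local_complement G vs) = pverts G"
  by (induct vs arbitrary: G) auto

lemma pair_graph_foldl_local_complement:
  "pair_graph G \<Longrightarrow> pair_graph (foldl local_complement G vs)"
  by (induct vs arbitrary: G) (auto intro: pair_graph_local_complement)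

lemma foldl_local_complement_map_graph:
  assumes "pair_graph G" "inj_on f (pverts G)" "set vs \<subseteq> pverts G"
  shows "foldl local_complement (map_graph f G) (map f vs) =
    map_graph f (foldl local_complement G vs)"
  using assms
proof (induct vs arbitrary: G)
  case (Cons v vs)
  interpret pair_graph G by fact
  show ?case
    using Cons pair_graph_local_complement[OF Cons.prems(1), of v]
    by (simp add: local_complement_map_graph[OF pair_wf_digraph_axioms])
qed simp

lemma foldl_local_complement_induced:
  assumes "set vs \<subseteq> S"
  shows "foldl local_complement (induced G S) vs = induced (foldl local_complement G vs) S"
  using assms by (induct vs arbitrary: G) (auto simp: local_complement_induced)

lemma neighbourhood_foldl_local_complement_nonempty:
  assumes "pair_graph G" "v \<notin> set vs" "neighbourhood G v \<noteq> {}"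
  shows "neighbourhood (foldl local_complement G vs) v \<noteq> {}"
  using assms
proof (induct vs arbitrary: G)
  case (Cons u vs)
  then have "neighbourhood (local_complement G u) v \<noteq> {}"
    by (intro neighbourhood_local_complement_nonempty) auto
  then show ?case using Cons by (simp add: pair_graph_local_complement)
qed simp

lemma neighbourhood_nonempty:
  assumes "connected_graph_on n G" "n \<ge> 2" "v \<in> pverts G"
  shows "neighbourhood G v \<noteq> {}"
proof -
  have "pverts G \<noteq> {v}" using assms by (auto simp: connected_graph_on_def)
  then obtain w where w: "w \<in> pverts G" "w \<noteq> v" using assms(3) by blast
  \<comment> \<open>A walk from \<open>v\<close> to another vertex leaves \<open>{v}\<close> along
    an arc at \<open>v\<close>.\<close>
  then have "(v, w) \<in> rtrancl_on (pverts G) (parcs G)"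
    using assms by (auto simp: connected_graph_on_def connected_pair_graph_iff)
  from rtrancl_on_leaves_set[OF this, of "{v}"] w show ?thesis by (auto simp: neighbourhood_def)
qed

section \<open>One-vertex extensions inside a given orbit\<close>

lemma map_graph_eq_extend_graph:
  assumes "pair_graph G" "v \<in> pverts G" "K = map_graph f (induced G (pverts G - {v}))"
  shows "map_graph (\<lambda>x. if x = v then None else Some (f x)) G =
    extend_graph K (f ` neighbourhood G v)" (is "map_graph ?g G = ?E")
proof -
  let ?N = "neighbourhood G v" and ?A = "parcs G"
  let ?B = "?A \<inter> (pverts G - {v}) \<times> (pverts G - {v})"
  \<comment> \<open>The arcs avoiding \<open>v\<close>, leaving \<open>v\<close> and entering
    \<open>v\<close> are mapped to the three parts of the arc set in
    \<open>extend_graph\<close>.\<close>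
  have A: "?A = ?B \<union> {v} \<times> ?N \<union> ?N \<times> {v}" and v: "v \<notin> ?N"
    using assms(1) unfolding pair_graph_iff
    by (auto simp: neighbourhood_def sym_def irrefl_def)
  have N: "?g ` ?N = Some ` f ` ?N" using v by (auto simp: image_image intro!: image_cong)
  have "map_prod ?g ?g ` ?B = map_prod Some Some ` map_prod f f ` ?B"
    unfolding image_image by (rule image_cong[OF refl]) (auto split: if_splits)
  moreover have "map_prod ?g ?g ` ({v} \<times> ?N) = {None} \<times> ?g ` ?N"
    "map_prod ?g ?g ` (?N \<times> {v}) = ?g ` ?N \<times> {None}"
    by (simp_all add: map_prod_surj_on[OF refl refl])
  ultimately have "map_prod ?g ?g ` ?A =
      map_prod Some Some ` map_prod f f ` ?B \<union> {None} \<times> Some ` f ` ?N \<union> Some ` f ` ?N \<times> {None}"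
    by (subst A) (simp only: image_Un N)
  moreover have "?g ` pverts G = insert None (Some ` f ` (pverts G - {v}))"
    using assms(2) by (auto simp: image_iff)
  ultimately show ?thesis using assms(3) by (simp add: extend_graph_def map_graph_def)
qed

theorem theorem14:
  fixes n :: nat
    and L :: "nat pair_pre_digraph set"
    and G :: "'a pair_pre_digraph"
  assumes "n \<ge> 2"
    and "lc_representatives (n - 1) L"
    and "connected_graph_on n G"
  shows "\<exists>H\<in>extensions L. unlabeled H \<in> lc_orbit G"
proof -
  have G: "pair_graph G" using assms(3) by (simp add: connected_graph_on_def)
  obtain v where v: "v \<in> pverts G"
    and conn: "connected_graph_on (n - 1) (induced G (pverts G - {v}))"
    using ex_connected_vertex_deletion[OF assms(3,1)] by blast
  let ?W = "pverts G - {v}"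
  have D: "pair_graph (induced G ?W)" using conn by (simp add: connected_graph_on_def)
  have "finite ?W" using G by (simp add: pair_graph_iff)
  \<comment> \<open>The orbits represented by \<open>L\<close> come from graphs over
    \<open>nat\<close>, so \<open>G\<close> without \<open>v\<close> is first copied there.\<close>
  then obtain h :: "'a \<Rightarrow> nat" where h: "inj_on h ?W"
    using finite_imp_inj_to_nat_seg[of ?W] by blast
  define K0 where "K0 = map_graph h (induced G ?W)"
  have "connected_graph_on (n - 1) K0"
    unfolding K0_def using conn h by (intro connected_graph_on_map_graph) auto
  then have "lc_orbit K0 \<in> connected_lc_orbits (n - 1)" by (auto simp: connected_lc_orbits_def)
  then obtain K where K: "K \<in> L" "unlabeled K \<in> lc_orbit K0" "connected_graph_on (n - 1) K"
    using assms(2) unfolding lc_representatives_def by blast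
  then obtain ws where "set ws \<subseteq> h ` ?W"
    and ws: "unlabeled K = unlabeled (foldl local_complement K0 ws)"
    by (auto simp: lc_orbit_def K0_def)
  \<comment> \<open>The complementations leading from \<open>K0\<close> to a copy of
    \<open>K\<close> are pulled back along \<open>h\<close> to vertices of \<open>G\<close> other
    than \<open>v\<close>.\<close>
  have "ws \<in> map h ` lists ?W"
    using \<open>set ws \<subseteq> h ` ?W\<close> by (simp only: lists_image[symmetric] in_lists_conv_set subset_code)
  then obtain vs where vs: "set vs \<subseteq> ?W" "ws = map h vs" by auto
  \<comment> \<open>The same sequence is run on all of \<open>G\<close>; since \<open>vs\<close>
    avoids \<open>v\<close>, deleting \<open>v\<close> afterwards gives a copy of
    \<open>K\<close>.\<close>
  define G' where "G' = foldl local_complement G vs"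
  have G': "pair_graph G'" "pverts G' = pverts G" "neighbourhood G' v \<noteq> {}"
    unfolding G'_def using vs(1) G neighbourhood_nonempty[OF assms(3,1) v]
    by (auto intro: pair_graph_foldl_local_complement dest: neighbourhood_foldl_local_complement_nonempty)
  have D': "pair_graph (induced G' ?W)" using G' by (intro pair_graph_induced) auto
  have "foldl local_complement K0 ws = map_graph h (induced G' ?W)"
    unfolding K0_def G'_def vs(2) using D h vs(1)
    by (simp add: foldl_local_complement_map_graph foldl_local_complement_induced)
  moreover have "pair_wf_digraph K" using K(3) by (simp add: connected_graph_on_def pair_wf_digraph_if_pair_graph)
  \<comment> \<open>The class of \<open>K\<close> contains \<open>K\<close> itself, which turns
    equality of classes into an actual isomorphism.\<close>
  then have "K \<in> unlabeled (foldl local_complement K0 ws)" using in_unlabeled_self ws by blast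
  moreover have "digraph_iso (with_proj (induced G' ?W)) (with_proj (map_graph h (induced G' ?W)))"
    using D' h pair_wf_digraph_if_pair_graph by (intro digraph_iso_map_graph) auto
  ultimately have "digraph_iso (with_proj (induced G' ?W)) (with_proj K)"
    by (auto simp: unlabeled_def intro: digraph_iso_trans)
  then obtain f where f: "inj_on f ?W" "K = map_graph f (induced G' ?W)"
    by (rule digraph_isoE_map_graph) simp
  \<comment> \<open>\<open>f\<close> extends to all of \<open>G'\<close> by sending \<open>v\<close>
    to the new vertex \<open>None\<close>; \<open>?S\<close> must then be the image of the
    neighbours that \<open>v\<close> has after the complementations.\<close>
  let ?g = "\<lambda>x. if x = v then None else Some (f x)" and ?S = "f ` neighbourhood G' v"
  have "inj_on ?g (pverts G')" using f(1) G'(2) by (auto simp: inj_on_def)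
  moreover have "map_graph ?g G' = extend_graph K ?S"
    by (rule map_graph_eq_extend_graph[OF G'(1)]) (use f(2) v G'(2) in simp_all)
  ultimately have "digraph_iso (with_proj G') (with_proj (extend_graph K ?S))"
    using digraph_iso_map_graph[of G' ?g] pair_wf_digraph_if_pair_graph[OF G'(1)] by simp
  then have "unlabeled (extend_graph K ?S) = unlabeled G'"
    using unlabeled_eq_iff pair_wf_digraph_if_pair_graph[OF G'(1)] by blast
  moreover have "unlabeled G' \<in> lc_orbit G" unfolding lc_orbit_def G'_def using vs(1) by auto
  moreover have "neighbourhood G' v \<subseteq> ?W"
    using G'(1,2) unfolding pair_graph_iff by (auto simp: neighbourhood_def irrefl_def)
  then have "?S \<subseteq> pverts K" using f(2) by auto
  then have "extend_graph K ?S \<in> extensions L"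
    using K(1) G'(3) unfolding extensions_def by blast
  ultimately show ?thesis by metis
qed

end
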